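(* The $T_2^*$-ideal $\mathrm{Id}^*_{\mathbb{Z}_2}(A)$ is generated, as a $T_2^*$-ideal, by the following polynomials: 1. $y^-$; 2. $[y_1^+,y_2^+]$; 3. $[z_1^+,z_2^+]$; 4. $[z_1^-,z_2^-]$; 5. $z_1^+\circ z_1^-$; 6. $[y^+,z_1z_2]$; 7. $[y_1^+,z_1y_2^+z_2]$; 8. $z_1z_2z_3$; 9. $z_1^+y^+z_2^+-z_2^+y^+z_1^+$; 10. $z_1^-y^+z_2^--z_2^-y^+z_1^-$; 11. $z_1^-y^+z_2^++z_2^+y^+z_1^-$; where in 6, 7 and 8 each $z_i$ is allowed to be either $z_i^+$ or $z_i^-$ (all choices are included).
   Context: $K$ is a field of characteristic zero, $e_{i,j}$ are the matrix units of $M_3(K)$, and $A = K(e_{1,1}+e_{3,3})\oplus Ke_{2,2}\oplus Ke_{1,2}\oplus Ke_{2,3}\oplus Ke_{1,3}$, with the $\mathbb{Z}_2$-grading $A_0=\mathrm{Span}(e_{1,1}+e_{3,3},e_{2,2},e_{1,3})$, $A_1=\mathrm{Span}(e_{1,2},e_{2,3})$ and the graded involution $*$ given by reflection along the secondary diagonal, $\begin{pmatrix} d&a&c\\0&g&b\\0&0&d\end{pmatrix}^*=\begin{pmatrix} d&b&c\\0&g&a\\0&0&d\end{pmatrix}$. Then $A_0^+=A_0$, $A_0^-=0$, $A_1^+=K(e_{1,2}+e_{2,3})$, $A_1^-=K(e_{1,2}-e_{2,3})$, where $A_i^{+}$, $A_i^-$ are the symmetric and skew-symmetric elements of $A_i$.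 The free unital $\mathbb{Z}_2$-graded algebra with graded involution $K\langle Y\cup Z,*\rangle$ is freely generated by variables $y_i^+$ (symmetric, even), $y_i^-$ (skew, even), $z_i^+$ (symmetric, odd), $z_i^-$ (skew, odd), $i\ge1$. $\mathrm{Id}^*_{\mathbb{Z}_2}(A)$ is the ideal of graded $*$-identities of $A$: polynomials vanishing whenever $y_i^+,y_i^-,z_i^+,z_i^-$ are replaced by elements of $A_0^+,A_0^-,A_1^+,A_1^-$ respectively. A $T_2^*$-ideal is an ideal invariant under all $\mathbb{Z}_2$-graded endomorphisms of the free algebra commuting with $*$. $[a,b]=ab-ba$ and $a\circ b=ab+ba$. *)

theory Defs
  imports "HOL-Analysis.Analysis" "HOL-Library.Poly_Mapping"
begin

section \<open>The free algebra with involution\<close>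

text \<open>
  The \<open>i\<close>-th symmetric even, skew even, symmetric odd and skew odd variables. All naturals,
  including 0, serve as indices; each kind has countably infinitely many variables.
\<close>

datatype var = Yp nat | Ym nat | Zp nat | Zm nat

fun is_skew :: "var \<Rightarrow> bool" where
  "is_skew (Yp i) = False"
| "is_skew (Ym i) = True"
| "is_skew (Zp i) = False"
| "is_skew (Zm i) = True"

fun is_odd :: "var \<Rightarrow> bool" where
  "is_odd (Yp i) = False"
| "is_odd (Ym i) = False"
| "is_odd (Zp i) = True"
| "is_odd (Zm i) = True"

text \<open>
  Lists are the free monoid, written additively because the convolution product on
  finitely supported functions uses the additive structure of the index type. Hence
  \<open>'k free\<close> is the monoid algebra of the free monoid on \<open>var\<close>, and
  \<open>Poly_Mapping.single w c\<close> is the monomial \<open>c w\<close>.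
\<close>

instantiation list :: (type) monoid_add
begin
definition zero_list :: "'a list" where "zero_list = []"
definition plus_list :: "'a list \<Rightarrow> 'a list \<Rightarrow> 'a list" where "plus_list xs ys = xs @ ys"
instance by standard (simp_all add: zero_list_def plus_list_def)
end

type_synonym 'k free = "var list \<Rightarrow>\<^sub>0 'k"

definition gen :: "var \<Rightarrow> 'k::field_char_0 free" where
  "gen v = Poly_Mapping.single [v] 1"

definition free_scale :: "'k::field_char_0 \<Rightarrow> 'k free \<Rightarrow> 'k free" where
  "free_scale c f = Poly_Mapping.single 0 c * f"

interpretation free: vector_space "free_scale :: 'k::field_char_0 \<Rightarrow> _"
  by standard
     (simp_all add: free_scale_def distrib_left distrib_right mult_single single_add
       flip: mult.assoc)

definition free_star :: "'k::field_char_0 free \<Rightarrow> 'k free" where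
  "free_star f = (\<Sum>w\<in>Poly_Mapping.keys f.
     Poly_Mapping.single (rev w) ((-1) ^ length (filter is_skew w) * Poly_Mapping.lookup f w))"

definition free_even :: "'k::field_char_0 free set" where
  "free_even = {f. \<forall>w\<in>Poly_Mapping.keys f. even (length (filter is_odd w))}"

definition free_odd :: "'k::field_char_0 free set" where
  "free_odd = {f. \<forall>w\<in>Poly_Mapping.keys f. odd (length (filter is_odd w))}"


section \<open>\<open>T\<^sub>2\<^sup>*\<close>-ideals\<close>

definition graded_star_endo :: "('k::field_char_0 free \<Rightarrow> 'k free) \<Rightarrow> bool" where
  "graded_star_endo \<phi> \<longleftrightarrow>
     Vector_Spaces.linear free_scale free_scale \<phi> \<and>
     \<phi> 1 = 1 \<and> (\<forall>f g. \<phi> (f * g) = \<phi> f * \<phi> g) \<and>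
     \<phi> ` free_even \<subseteq> free_even \<and> \<phi> ` free_odd \<subseteq> free_odd \<and>
     (\<forall>f. \<phi> (free_star f) = free_star (\<phi> f))"

definition two_sided_ideal :: "'a::ring_1 set \<Rightarrow> bool" where
  "two_sided_ideal I \<longleftrightarrow>
     0 \<in> I \<and> (\<forall>a\<in>I. \<forall>b\<in>I. a + b \<in> I) \<and> (\<forall>a\<in>I. \<forall>r. r * a \<in> I \<and> a * r \<in> I)"

definition T2_star_ideal :: "'k::field_char_0 free set \<Rightarrow> bool" where
  "T2_star_ideal I \<longleftrightarrow> two_sided_ideal I \<and> (\<forall>\<phi>. graded_star_endo \<phi> \<longrightarrow> \<phi> ` I \<subseteq> I)"


section \<open>The algebra \<open>A\<close>\<close>

text \<open>The product of matrices is \<open>**\<close> and the unit is \<open>mat 1\<close>; the operation \<open>*\<close> on vectors is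
  componentwise and is not used for matrices.\<close>

type_synonym 'k mat3 = "'k^3^3"

definition mscale :: "'k::field_char_0 \<Rightarrow> 'k mat3 \<Rightarrow> 'k mat3" where
  "mscale c M = (\<chi> i j. c * M $ i $ j)"

interpretation mat3: vector_space "mscale :: 'k::field_char_0 \<Rightarrow> _"
  by standard (simp_all add: mscale_def vec_eq_iff algebra_simps)

definition mat_unit :: "3 \<Rightarrow> 3 \<Rightarrow> 'k::field_char_0 mat3" where
  "mat_unit i j = (\<chi> k l. if k = i \<and> l = j then 1 else 0)"

definition alg_A :: "'k::field_char_0 mat3 set" where
  "alg_A = module.span mscale {mat_unit 1 1 + mat_unit 3 3, mat_unit 2 2, mat_unit 1 2, mat_unit 2 3, mat_unit 1 3}"

definition A0 :: "'k::field_char_0 mat3 set" where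
  "A0 = module.span mscale {mat_unit 1 1 + mat_unit 3 3, mat_unit 2 2, mat_unit 1 3}"

definition A1 :: "'k::field_char_0 mat3 set" where
  "A1 = module.span mscale {mat_unit 1 2, mat_unit 2 3}"

text \<open>Reflection along the secondary diagonal; \<open>4 - i\<close> is computed in the type \<open>3\<close> of
  integers modulo 3, where it exchanges 1 and 3 and fixes 2.\<close>

definition mstar :: "'k::field_char_0 mat3 \<Rightarrow> 'k mat3" where
  "mstar M = (\<chi> i j. M $ (4 - j) $ (4 - i))"

definition sym_part :: "'k::field_char_0 mat3 set \<Rightarrow> 'k mat3 set" where
  "sym_part S = {a \<in> S. mstar a = a}"

definition skew_part :: "'k::field_char_0 mat3 set \<Rightarrow> 'k mat3 set" where
  "skew_part S = {a \<in> S. mstar a = - a}"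

definition upper :: "'k::field_char_0 \<Rightarrow> 'k \<Rightarrow> 'k \<Rightarrow> 'k \<Rightarrow> 'k \<Rightarrow> 'k mat3" where
  "upper d g a b c = vector [vector [d, a, c], vector [0, g, b], vector [0, 0, d]]"

lemma mstar_upper: "mstar (upper d g a b c) = upper d g b a c"
  by (simp add: mstar_def upper_def vec_eq_iff forall_3)

lemma alg_A_eq: "alg_A = {upper d g a b c | d g a b c. True}"
proof -
  have "M \<in> alg_A \<longleftrightarrow> (\<exists>d g a b c. M = upper d g a b c)" for M :: "'a mat3"
  proof -
    have "M \<in> alg_A \<longleftrightarrow> (\<exists>d g a b c. M = mscale d (mat_unit 1 1 + mat_unit 3 3) + mscale g (mat_unit 2 2) +
        mscale a (mat_unit 1 2) + mscale b (mat_unit 2 3) + mscale c (mat_unit 1 3))"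
      by (simp add: alg_A_def mat3.span_breakdown_eq algebra_simps)
    also have "\<dots> \<longleftrightarrow> (\<exists>d g a b c. M = upper d g a b c)"
      by (simp add: upper_def mscale_def mat_unit_def vec_eq_iff forall_3)
    finally show ?thesis .
  qed
  then show ?thesis by blast
qed

lemma sym_part_A0: "sym_part A0 = (A0 :: 'a::field_char_0 mat3 set)"
  and skew_part_A0: "skew_part A0 = ({0} :: 'a mat3 set)"
proof -
  have *: "M \<in> A0 \<longleftrightarrow> (\<exists>d g c. M = upper d g 0 0 c)" for M :: "'a mat3"
  proof -
    have "M \<in> A0 \<longleftrightarrow> (\<exists>d g c. M = mscale d (mat_unit 1 1 + mat_unit 3 3) + mscale g (mat_unit 2 2) + mscale c (mat_unit 1 3))"
      by (simp add: A0_def mat3.span_breakdown_eq algebra_simps)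
    also have "\<dots> \<longleftrightarrow> (\<exists>d g c. M = upper d g 0 0 c)"
      by (simp add: upper_def mscale_def mat_unit_def vec_eq_iff forall_3)
    finally show ?thesis .
  qed
  have sym: "mstar M = M" if "M \<in> A0" for M :: "'a mat3"
    using that unfolding * by (auto simp: mstar_upper)
  then show "sym_part A0 = (A0 :: 'a mat3 set)"
    by (auto simp: sym_part_def)
  show "skew_part A0 = ({0} :: 'a mat3 set)"
    using sym by (auto simp: skew_part_def A0_def mat3.span_zero vec_eq_iff mstar_def)
qed

lemma sym_part_A1: "sym_part A1 =
    (module.span mscale {mat_unit 1 2 + mat_unit 2 3} :: 'a::field_char_0 mat3 set)"
  and skew_part_A1: "skew_part A1 =
    (module.span mscale {mat_unit 1 2 - mat_unit 2 3} :: 'a mat3 set)"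
proof -
  have *: "M \<in> A1 \<longleftrightarrow> (\<exists>a b. M = upper 0 0 a b 0)" for M :: "'a mat3"
  proof -
    have "M \<in> A1 \<longleftrightarrow> (\<exists>a b. M = mscale a (mat_unit 1 2) + mscale b (mat_unit 2 3))"
      by (simp add: A1_def mat3.span_breakdown_eq algebra_simps)
    also have "\<dots> \<longleftrightarrow> (\<exists>a b. M = upper 0 0 a b 0)"
      by (simp add: upper_def mscale_def mat_unit_def vec_eq_iff forall_3)
    finally show ?thesis .
  qed
  have "M \<in> sym_part A1 \<longleftrightarrow> (\<exists>k. M = mscale k (mat_unit 1 2 + mat_unit 2 3))" for M :: "'a mat3"
    by (auto simp: sym_part_def * upper_def mscale_def mstar_def mat_unit_def vec_eq_iff forall_3)
  then show "sym_part A1 = (module.span mscale {mat_unit 1 2 + mat_unit 2 3} :: 'a mat3 set)"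
    by (auto simp: mat3.span_singleton)
  have "M \<in> skew_part A1 \<longleftrightarrow> (\<exists>k. M = mscale k (mat_unit 1 2 - mat_unit 2 3))" for M :: "'a mat3"
    by (auto simp: skew_part_def * upper_def mscale_def mstar_def mat_unit_def vec_eq_iff forall_3)
  then show "skew_part A1 = (module.span mscale {mat_unit 1 2 - mat_unit 2 3} :: 'a mat3 set)"
    by (auto simp: mat3.span_singleton)
qed


section \<open>Graded \<open>*\<close>-identities of \<open>A\<close>\<close>

definition admissible :: "(var \<Rightarrow> 'k::field_char_0 mat3) \<Rightarrow> bool" where
  "admissible \<rho> \<longleftrightarrow> (\<forall>i. \<rho> (Yp i) \<in> sym_part A0 \<and> \<rho> (Ym i) \<in> skew_part A0 \<and>
                        \<rho> (Zp i) \<in> sym_part A1 \<and> \<rho> (Zm i) \<in> skew_part A1)"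

definition eval_word :: "(var \<Rightarrow> 'k::field_char_0 mat3) \<Rightarrow> var list \<Rightarrow> 'k mat3" where
  "eval_word \<rho> w = foldr (\<lambda>v M. \<rho> v ** M) w (mat 1)"

definition eval_free :: "(var \<Rightarrow> 'k::field_char_0 mat3) \<Rightarrow> 'k free \<Rightarrow> 'k mat3" where
  "eval_free \<rho> f =
     (\<Sum>w\<in>Poly_Mapping.keys f. mscale (Poly_Mapping.lookup f w) (eval_word \<rho> w))"

definition Id_A :: "'k::field_char_0 free set" where
  "Id_A = {f. \<forall>\<rho>. admissible \<rho> \<longrightarrow> eval_free \<rho> f = 0}"


section \<open>The generating polynomials\<close>

definition commutator :: "'a::ring_1 \<Rightarrow> 'a \<Rightarrow> 'a" where
  "commutator a b = a * b - b * a"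

definition jordan :: "'a::ring_1 \<Rightarrow> 'a \<Rightarrow> 'a" where
  "jordan a b = a * b + b * a"

abbreviation "yp i \<equiv> gen (Yp i)"
abbreviation "ym i \<equiv> gen (Ym i)"
abbreviation "zp i \<equiv> gen (Zp i)"
abbreviation "zm i \<equiv> gen (Zm i)"

definition generators :: "'k::field_char_0 free set" where
  "generators =
     {ym 1,
      commutator (yp 1) (yp 2),
      commutator (zp 1) (zp 2),
      commutator (zm 1) (zm 2),
      jordan (zp 1) (zm 1)}
   \<union> {commutator (yp 1) (z1 * z2) | z1 z2. z1 \<in> {zp 1, zm 1} \<and> z2 \<in> {zp 2, zm 2}}
   \<union> {commutator (yp 1) (z1 * yp 2 * z2) | z1 z2. z1 \<in> {zp 1, zm 1} \<and> z2 \<in> {zp 2, zm 2}}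
   \<union> {z1 * z2 * z3 | z1 z2 z3.
        z1 \<in> {zp 1, zm 1} \<and> z2 \<in> {zp 2, zm 2} \<and> z3 \<in> {zp 3, zm 3}}
   \<union> {zp 1 * yp 1 * zp 2 - zp 2 * yp 1 * zp 1,
      zm 1 * yp 1 * zm 2 - zm 2 * yp 1 * zm 1,
      zm 1 * yp 1 * zp 2 + zp 2 * yp 1 * zm 1}"

end

theory Submission
  imports Defs
begin

text \<open>The identities of \<open>A\<close> form a \<open>T\<^sub>2\<^sup>*\<close>-ideal because composing an admissible evaluation
  with a graded endomorphism commuting with the involution gives another admissible evaluation, and
  the listed polynomials are identities by direct multiplication of matrices. The content lies in the
  other inclusion: every \<open>T\<^sub>2\<^sup>*\<close>-ideal \<open>I\<close> containing the generators contains all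
  identities of \<open>A\<close>.

  Modulo \<open>I\<close> there are few words. The symmetric even variables commute with each other. For odd
  letters \<open>z, z'\<close> and a word \<open>v\<close> in symmetric even variables, \<open>z v z'\<close> commutes with every
  symmetric even variable (\<open>odd_pair_central\<close>), and \<open>z v z'\<close> and \<open>z' v z\<close> agree up to a
  sign (\<open>odd_pair_swap\<close>). The generators give this only with a symmetric element in the middle, but
  \<open>v\<close> is congruent to its symmetrization \<open>(v + v\<^sup>*)/2\<close>. It follows that words with three odd
  letters vanish, as do words containing a skew even variable. The other words are called normal.
  They have the shape \<open>u\<close>, \<open>u z v\<close> or
  \<open>u z v z' x\<close> with even words \<open>u\<close>, \<open>v\<close>, \<open>x\<close>. A normal word carries a
  sign and a multiset of weights, which records its odd letters and its even letters, the latter marked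
  as inner if exactly one odd letter precedes them and as outer otherwise. Normal words with the same weights are congruent up to their signs
  (\<open>normal_congr\<close>).

  Conversely, the weights can be seen in \<open>A\<close>. Replace \<open>y\<^sub>i\<^sup>+\<close> by
  \<open>diag(d\<^sub>i, g\<^sub>i, d\<^sub>i)\<close> and each odd variable by a scalar multiple of
  \<open>e\<^sub>1\<^sub>2 \<plusminus> e\<^sub>2\<^sub>3\<close>. The first row of the value of a normal word has then exactly one
  nonzero entry, namely the sign times a monomial: outer letters contribute \<open>d\<^sub>i\<close>, inner ones
  \<open>g\<^sub>i\<close>, odd ones their scalar (\<open>row_sum_normal\<close>). Distinct multisets of weights give
  distinct monomials. To separate monomials by points of \<open>K\<close>, the parameters are taken to be
  \<open>k\<close>-th powers of distinct primes: the monomials become \<open>k\<close>-th powers of distinct natural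
  numbers, and a linear relation between these for all \<open>k\<close> is trivial
  (\<open>vanishing_power_sums\<close>). Hence in an identity the signed coefficients of the words with any
  given weights add up to zero, so the identity is a combination of elements of \<open>I\<close>
  (\<open>Id_A_subset\<close>).\<close>

section \<open>Additive maps on the free algebra\<close>

lemma free_induct [case_names single add]:
  fixes f :: "'a \<Rightarrow>\<^sub>0 'b::comm_monoid_add"
  assumes single: "\<And>w c. P (Poly_Mapping.single w c)"
    and add: "\<And>f g. P f \<Longrightarrow> P g \<Longrightarrow> P (f + g)"
  shows "P f"
proof (induction f rule: update_induct)
  case const
  show ?case using single[of undefined 0] by simp
next
  case (update f w c)
  have "Poly_Mapping.update w c f = f + Poly_Mapping.single w c"
    using update.hyps by (intro poly_mapping_eqI)
      (auto simp: lookup_update lookup_add lookup_single in_keys_iff)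
  then show ?case using add[OF update.IH single] by simp
qed

lemma additive_eq:
  fixes F G :: "('a \<Rightarrow>\<^sub>0 'b::comm_monoid_add) \<Rightarrow> 'c::ab_group_add"
  assumes "\<And>f g. F (f + g) = F f + F g" "\<And>f g. G (f + g) = G f + G g"
    and "\<And>w c. F (Poly_Mapping.single w c) = G (Poly_Mapping.single w c)"
  shows "F f = G f"
  by (induction f rule: free_induct) (simp_all add: assms)

text \<open>The form in which multiplicativity is used for evaluations, for substitutions and, with the
  factors of \<open>m\<close> swapped, for the involution.\<close>

lemma multiplicative_if_on_monomials:
  fixes F :: "'k::field_char_0 free \<Rightarrow> 'c::ab_group_add"
  assumes add: "\<And>f g. F (f + g) = F f + F g"
    and m_add: "\<And>x y z. m (x + y) z = m x z + m y z" "\<And>x y z. m x (y + z) = m x y + m x z"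
    and mon: "\<And>u v a b. F (Poly_Mapping.single (u @ v) (a * b)) =
      m (F (Poly_Mapping.single u a)) (F (Poly_Mapping.single v b))"
  shows "F (f * g) = m (F f) (F g)"
proof (induction f rule: free_induct)
  case (single u a)
  show ?case
    by (induction g rule: free_induct)
      (simp_all add: mult_single plus_list_def mon distrib_left add m_add)
qed (simp add: distrib_right add m_add)

definition mon :: "var list \<Rightarrow> 'k::field_char_0 free" where
  "mon w = Poly_Mapping.single w 1"

lemma mon_Nil [simp]: "mon [] = 1"
  using single_one[where 'a = "var list"] by (simp add: mon_def zero_list_def)

lemma mon_append: "mon (u @ v) = mon u * mon v"
  by (simp add: mon_def mult_single plus_list_def)

lemma gen_eq_mon: "gen v = mon [v]"
  by (simp add: gen_def mon_def)

lemma mon_Cons: "mon (v # w) = gen v * mon w"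
  using mon_append[of "[v]" w] by (simp add: gen_eq_mon)

lemma free_scale_single [simp]:
  "free_scale c (Poly_Mapping.single w a) = Poly_Mapping.single w (c * a)"
  by (simp add: free_scale_def mult_single)

lemma single_eq_scale_mon: "Poly_Mapping.single w c = free_scale c (mon w)"
  by (simp add: mon_def)

lemma single_Nil_central:
  "Poly_Mapping.single (0::var list) (c::'k::field_char_0) * f = f * Poly_Mapping.single 0 c"
  by (rule additive_eq[where f = f])
    (simp_all add: distrib_left distrib_right mult_single mult.commute)

lemma free_scale_mult_left: "free_scale c f * g = free_scale c (f * g)"
  by (simp add: free_scale_def mult.assoc)

lemma free_scale_mult_right: "f * free_scale c g = free_scale c (f * g)"
  by (metis free_scale_def mult.assoc single_Nil_central)

section \<open>The grading and the involution\<close>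

definition homog :: "bool \<Rightarrow> 'k::field_char_0 free \<Rightarrow> bool" where
  "homog b f \<longleftrightarrow> (\<forall>w\<in>Poly_Mapping.keys f. odd (length (filter is_odd w)) = b)"

lemma free_even_iff: "f \<in> free_even \<longleftrightarrow> homog False f"
  by (simp add: free_even_def homog_def)

lemma free_odd_iff: "f \<in> free_odd \<longleftrightarrow> homog True f"
  by (simp add: free_odd_def homog_def)

lemma homog_0 [simp]: "homog b 0"
  by (simp add: homog_def)

lemma homog_add: "homog b f \<Longrightarrow> homog b g \<Longrightarrow> homog b (f + g)"
  using keys_add[of f g] by (auto simp: homog_def)

lemma homog_mult:
  assumes "homog a f" "homog b g"
  shows "homog (a \<noteq> b) (f * g)"
  unfolding homog_def
proof
  fix w assume "w \<in> Poly_Mapping.keys (f * g)"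
  then obtain u v where "w = u + v" "u \<in> Poly_Mapping.keys f" "v \<in> Poly_Mapping.keys g"
    using keys_mult[of f g] by blast
  then show "odd (length (filter is_odd w)) = (a \<noteq> b)"
    using assms by (auto simp: homog_def plus_list_def)
qed

lemma homog_single: "odd (length (filter is_odd w)) = b \<Longrightarrow> homog b (Poly_Mapping.single w c)"
  by (simp add: homog_def)

lemma homog_scale: "homog b f \<Longrightarrow> homog b (free_scale c f)"
  using homog_mult[OF homog_single[of 0 False c], of b f]
  by (simp add: free_scale_def zero_list_def)

lemma homog_gen: "homog (is_odd v) (gen v)"
  by (simp add: gen_def homog_single)

lemma homog_sum: "(\<And>x. x \<in> S \<Longrightarrow> homog b (h x)) \<Longrightarrow> homog b (sum h S)"
  by (induction S rule: infinite_finite_induct) (simp_all add: homog_add)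

lemma free_star_add: "free_star (f + g) = free_star f + free_star g"
  unfolding free_star_def
  by (rule setsum_keys_plus_distrib) (simp_all add: distrib_left single_add)

lemma free_star_single:
  "free_star (Poly_Mapping.single w c) =
     Poly_Mapping.single (rev w) ((-1) ^ length (filter is_skew w) * c)"
  by (simp add: free_star_def)

lemma free_star_mult: "free_star (f * g) = free_star g * free_star f"
  by (rule multiplicative_if_on_monomials[where m = "\<lambda>x y. y * x"])
    (simp_all add: free_star_add free_star_single mult_single plus_list_def distrib_left
      distrib_right power_add ac_simps)

lemma free_star_scale: "free_star (free_scale c f) = free_scale c (free_star f)"
  by (rule additive_eq[where f = f])
    (simp_all add: free_star_add free_star_single free.scale_right_distrib ac_simps)

lemma free_star_gen: "free_star (gen v) = (if is_skew v then - gen v else gen v)"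
  by (simp add: gen_def free_star_single single_uminus)

section \<open>Substitutions\<close>

definition subst :: "(var \<Rightarrow> 'k::field_char_0 free) \<Rightarrow> 'k free \<Rightarrow> 'k free" where
  "subst \<sigma> f = (\<Sum>w\<in>Poly_Mapping.keys f.
     free_scale (Poly_Mapping.lookup f w) (prod_list (map \<sigma> w)))"

text \<open>By freeness, these are the assignments of the variables that extend to graded endomorphisms
  commuting with the involution.\<close>

definition star_compatible :: "(var \<Rightarrow> 'k::field_char_0 free) \<Rightarrow> bool" where
  "star_compatible \<sigma> \<longleftrightarrow> (\<forall>v. homog (is_odd v) (\<sigma> v) \<and>
     free_star (\<sigma> v) = (if is_skew v then - \<sigma> v else \<sigma> v))"

lemma subst_add: "subst \<sigma> (f + g) = subst \<sigma> f + subst \<sigma> g"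
  unfolding subst_def by (rule setsum_keys_plus_distrib) (simp_all add: free.scale_left_distrib)

lemma subst_single:
  "subst \<sigma> (Poly_Mapping.single w c) = free_scale c (prod_list (map \<sigma> w))"
  by (simp add: subst_def)

lemma subst_gen [simp]: "subst \<sigma> (gen v) = \<sigma> v"
  by (simp add: gen_def subst_single)

lemma subst_mult: "subst \<sigma> (f * g) = subst \<sigma> f * subst \<sigma> g"
  by (rule multiplicative_if_on_monomials)
    (simp_all add: subst_add subst_single distrib_left distrib_right free_scale_mult_left
      free_scale_mult_right)

lemma subst_scale: "subst \<sigma> (free_scale c f) = free_scale c (subst \<sigma> f)"
  by (rule additive_eq[where f = f]) (simp_all add: subst_add subst_single free.scale_right_distrib)

lemma subst_diff: "subst \<sigma> (f - g) = subst \<sigma> f - subst \<sigma> g"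
  by (metis add_diff_cancel diff_add_cancel subst_add)

lemma homog_subst:
  assumes "star_compatible \<sigma>" "homog b f"
  shows "homog b (subst \<sigma> f)"
proof -
  have "homog (odd (length (filter is_odd w))) (prod_list (map \<sigma> w))" for w
  proof (induction w)
    case Nil
    have "homog False (mon [] :: 'a free)" unfolding mon_def by (rule homog_single) simp
    then show ?case by simp
  next
    case (Cons v w)
    have "homog (is_odd v) (\<sigma> v)" using assms(1) by (simp add: star_compatible_def)
    from homog_mult[OF this Cons.IH] show ?case by (cases "is_odd v") simp_all
  qed
  with assms(2) have "homog b (prod_list (map \<sigma> w))" if "w \<in> Poly_Mapping.keys f" for w
    using that by (metis homog_def)
  then show ?thesis unfolding subst_def by (intro homog_sum homog_scale)
qed

lemma free_star_subst:
  assumes "star_compatible \<sigma>"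
  shows "subst \<sigma> (free_star f) = free_star (subst \<sigma> f)"
proof -
  have "free_star (prod_list (map \<sigma> w)) =
      free_scale ((-1) ^ length (filter is_skew w)) (prod_list (map \<sigma> (rev w)))" for w
  proof (induction w)
    case Nil
    show ?case using free_star_single[of "[]" "1::'a"] by (simp flip: mon_def)
  next
    case (Cons v w)
    have "free_star (\<sigma> v) = (if is_skew v then - \<sigma> v else \<sigma> v)"
      using assms by (simp add: star_compatible_def)
    then show ?case
      by (simp add: free_star_mult Cons.IH free_scale_mult_left free.scale_minus_left)
  qed
  then show ?thesis
    by - (rule additive_eq[where f = f],
      simp_all add: subst_add free_star_add subst_single free_star_single free_star_scale mult.commute)
qed

lemma graded_star_endo_subst:
  assumes "star_compatible \<sigma>"
  shows "graded_star_endo (subst \<sigma>)"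
proof -
  have "Vector_Spaces.linear free_scale free_scale (subst \<sigma>)"
    by unfold_locales (simp_all add: subst_add subst_scale)
  moreover have "subst \<sigma> 1 = 1"
    using subst_single[of \<sigma> "[]" 1] by (simp flip: mon_def)
  ultimately show ?thesis
    using homog_subst[OF assms] free_star_subst[OF assms]
    by (auto simp: graded_star_endo_def subst_mult free_even_iff free_odd_iff)
qed

section \<open>Evaluation in A\<close>

lemmas upper_simps = upper_def mscale_def mat_def vec_eq_iff forall_3 sum_3 matrix_matrix_mult_def

lemma upper_mult:
  "upper d g a b c ** upper d' g' a' b' c' =
     upper (d * d') (g * g') (d * a' + a * g') (g * b' + b * d') (d * c' + a * b' + c * d')"
  by (simp add: upper_simps)

lemma upper_one: "mat 1 = upper 1 1 0 0 0"
  by (simp add: upper_simps)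

lemma upper_zero: "0 = upper 0 0 0 0 0"
  by (simp add: upper_simps)

lemma upper_add:
  "upper d g a b c + upper d' g' a' b' c' = upper (d + d') (g + g') (a + a') (b + b') (c + c')"
  by (simp add: upper_simps)

lemma upper_minus: "- upper d g a b c = upper (- d) (- g) (- a) (- b) (- c)"
  by (simp add: upper_simps)

lemma upper_diff:
  "upper d g a b c - upper d' g' a' b' c' = upper (d - d') (g - g') (a - a') (b - b') (c - c')"
  by (simp add: upper_simps)

lemma upper_eq_iff:
  "upper d g a b c = upper d' g' a' b' c' \<longleftrightarrow> d = d' \<and> g = g' \<and> a = a' \<and> b = b' \<and> c = c'"
  by (auto simp: upper_simps)

lemma A0_iff: "M \<in> A0 \<longleftrightarrow> (\<exists>d g c. M = upper d g 0 0 c)"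
proof -
  have "M \<in> A0 \<longleftrightarrow> (\<exists>d g c. M = mscale d (mat_unit 1 1 + mat_unit 3 3) +
      mscale g (mat_unit 2 2) + mscale c (mat_unit 1 3))"
    by (simp add: A0_def mat3.span_breakdown_eq algebra_simps)
  also have "\<dots> \<longleftrightarrow> (\<exists>d g c. M = upper d g 0 0 c)"
    by (simp add: upper_def mscale_def mat_unit_def vec_eq_iff forall_3)
  finally show ?thesis .
qed

lemma A1_iff: "M \<in> A1 \<longleftrightarrow> (\<exists>a b. M = upper 0 0 a b 0)"
proof -
  have "M \<in> A1 \<longleftrightarrow> (\<exists>a b. M = mscale a (mat_unit 1 2) + mscale b (mat_unit 2 3))"
    by (simp add: A1_def mat3.span_breakdown_eq algebra_simps)
  also have "\<dots> \<longleftrightarrow> (\<exists>a b. M = upper 0 0 a b 0)"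
    by (simp add: upper_def mscale_def mat_unit_def vec_eq_iff forall_3)
  finally show ?thesis .
qed

lemma sym_A0_iff: "M \<in> sym_part A0 \<longleftrightarrow> (\<exists>d g c. M = upper d g 0 0 c)"
  by (auto simp: sym_part_def A0_iff mstar_upper)

lemma sym_A1_iff: "M \<in> sym_part A1 \<longleftrightarrow> (\<exists>a. M = upper 0 0 a a 0)"
proof
  assume "M \<in> sym_part A1"
  then obtain a b where M: "M = upper 0 0 a b 0" and "mstar M = M"
    by (auto simp: sym_part_def A1_iff)
  then have "upper 0 0 b a 0 = upper 0 0 a b 0" by (simp add: mstar_upper)
  then have "b = a" unfolding upper_eq_iff by blast
  with M show "\<exists>a. M = upper 0 0 a a 0" by blast
qed (auto simp: sym_part_def A1_iff mstar_upper)

lemma skew_A1_iff: "M \<in> skew_part A1 \<longleftrightarrow> (\<exists>a. M = upper 0 0 a (- a) 0)"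
proof
  assume "M \<in> skew_part A1"
  then obtain a b where M: "M = upper 0 0 a b 0" and "mstar M = - M"
    by (auto simp: skew_part_def A1_iff)
  then have "upper 0 0 b a 0 = upper 0 0 (- a) (- b) 0"
    by (simp add: mstar_upper upper_minus)
  then have "b = - a" unfolding upper_eq_iff by blast
  with M show "\<exists>a. M = upper 0 0 a (- a) 0" by blast
qed (auto simp: skew_part_def A1_iff mstar_upper upper_minus)

definition component :: "bool \<Rightarrow> 'k::field_char_0 mat3 set" where
  "component b = (if b then A1 else A0)"

lemma admissible_iff:
  "admissible \<rho> \<longleftrightarrow> (\<forall>v. \<rho> v \<in> component (is_odd v) \<and>
     mstar (\<rho> v) = (if is_skew v then - \<rho> v else \<rho> v))"
proof -
  have "(\<forall>v. P v) \<longleftrightarrow> (\<forall>i. P (Yp i) \<and> P (Ym i) \<and> P (Zp i) \<and> P (Zm i))" for P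
    by (metis var.exhaust)
  from this[of "\<lambda>v. \<rho> v \<in> component (is_odd v) \<and>
      mstar (\<rho> v) = (if is_skew v then - \<rho> v else \<rho> v)"]
  show ?thesis by (simp add: admissible_def component_def sym_part_def skew_part_def)
qed

lemma admissible_cases:
  assumes "admissible \<rho>"
  shows "\<exists>d g c. \<rho> (Yp i) = upper d g 0 0 c" "\<rho> (Ym i) = 0"
    "\<exists>a. \<rho> (Zp i) = upper 0 0 a a 0" "\<exists>a. \<rho> (Zm i) = upper 0 0 a (- a) 0"
  using assms by (simp_all add: admissible_def sym_A0_iff skew_part_A0 sym_A1_iff skew_A1_iff)

lemma component_mult:
  "M \<in> component a \<Longrightarrow> N \<in> component b \<Longrightarrow> M ** N \<in> component (a \<noteq> b)"
  by (cases a; cases b)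
    (auto simp: component_def A0_iff A1_iff upper_mult upper_eq_iff)

lemma component_subspace: "mat3.subspace (component b)"
  by (simp add: component_def A0_def A1_def mat3.subspace_span)

lemma mmult_add_left: "(M + N) ** (P :: 'k::field_char_0 mat3) = M ** P + N ** P"
  by (simp add: vec_eq_iff matrix_matrix_mult_def sum.distrib algebra_simps)

lemma mmult_mscale: "mscale a M ** N = mscale a (M ** N)" "M ** mscale a N = mscale a (M ** N)"
  by (simp_all add: vec_eq_iff matrix_matrix_mult_def mscale_def sum_distrib_left ac_simps)

lemma mstar_add: "mstar (M + N) = mstar M + mstar N"
  by (simp add: mstar_def vec_eq_iff)

lemma mstar_mscale: "mstar (mscale c M) = mscale c (mstar M)"
  by (simp add: mstar_def mscale_def vec_eq_iff)

lemma component_upper: "M \<in> component i \<Longrightarrow> \<exists>d g a b c. M = upper d g a b c"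
  unfolding component_def by (cases i) (simp_all add: A0_iff A1_iff, blast+)

lemma mstar_mult:
  assumes "M \<in> component a" "N \<in> component b"
  shows "mstar (M ** N) = mstar N ** mstar M"
  using component_upper[OF assms(1)] component_upper[OF assms(2)]
  by (auto simp: mstar_upper upper_mult upper_eq_iff algebra_simps)

lemma eval_word_Nil [simp]: "eval_word \<rho> [] = mat 1"
  and eval_word_Cons [simp]: "eval_word \<rho> (v # w) = \<rho> v ** eval_word \<rho> w"
  by (simp_all add: eval_word_def)

lemma eval_word_append: "eval_word \<rho> (u @ v) = eval_word \<rho> u ** eval_word \<rho> v"
  by (induction u) (simp_all add: matrix_mul_assoc)

lemma eval_free_add: "eval_free \<rho> (f + g) = eval_free \<rho> f + eval_free \<rho> g"
  unfolding eval_free_def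
  by (rule setsum_keys_plus_distrib) (simp_all add: mat3.scale_left_distrib)

lemma eval_free_single: "eval_free \<rho> (Poly_Mapping.single w c) = mscale c (eval_word \<rho> w)"
  by (simp add: eval_free_def)

lemma eval_free_0 [simp]: "eval_free \<rho> 0 = 0"
  by (simp add: eval_free_def)

lemma eval_free_gen [simp]: "eval_free \<rho> (gen v) = \<rho> v"
  by (simp add: gen_def eval_free_single)

lemma eval_free_diff: "eval_free \<rho> (f - g) = eval_free \<rho> f - eval_free \<rho> g"
  by (metis add_diff_cancel diff_add_cancel eval_free_add)

lemma eval_free_mult: "eval_free \<rho> (f * g) = eval_free \<rho> f ** eval_free \<rho> g"
  by (rule multiplicative_if_on_monomials)
    (simp_all add: eval_free_add eval_free_single mmult_add_left matrix_add_ldistrib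
      eval_word_append mmult_mscale)

lemma eval_free_scale: "eval_free \<rho> (free_scale c f) = mscale c (eval_free \<rho> f)"
  by (rule additive_eq[where f = f])
    (simp_all add: eval_free_add eval_free_single free.scale_right_distrib
      mat3.scale_right_distrib)

lemma eval_word_component:
  assumes "admissible \<rho>"
  shows "eval_word \<rho> w \<in> component (odd (length (filter is_odd w)))"
proof (induction w)
  case Nil
  show ?case by (auto simp: component_def A0_iff upper_one upper_eq_iff)
next
  case (Cons v w)
  have "\<rho> v \<in> component (is_odd v)" using assms by (simp add: admissible_iff)
  from component_mult[OF this Cons.IH] show ?case by (cases "is_odd v") simp_all
qed

lemma eval_free_component:
  assumes "admissible \<rho>" "homog b f"
  shows "eval_free \<rho> f \<in> component b"
proof -
  have "eval_word \<rho> w \<in> component b" if "w \<in> Poly_Mapping.keys f" for w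
    using that assms(2) eval_word_component[OF assms(1), of w] by (simp add: homog_def)
  then show ?thesis
    unfolding eval_free_def
    by (intro mat3.subspace_sum mat3.subspace_scale component_subspace)
qed

text \<open>With the preceding lemma, this makes the values of \<open>\<phi> (gen v)\<close>, for a graded endomorphism
  \<open>\<phi>\<close> that commutes with the involution, an admissible choice for the variable \<open>v\<close>.\<close>

lemma eval_free_star:
  assumes "admissible \<rho>"
  shows "eval_free \<rho> (free_star f) = mstar (eval_free \<rho> f)"
proof -
  have "mstar (eval_word \<rho> w) =
      mscale ((-1) ^ length (filter is_skew w)) (eval_word \<rho> (rev w))" for w
  proof (induction w)
    case Nil
    show ?case by (simp add: upper_one mstar_upper)
  next
    case (Cons v w)
    have v: "\<rho> v \<in> component (is_odd v)" "mstar (\<rho> v) = (if is_skew v then - \<rho> v else \<rho> v)"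
      using assms by (simp_all add: admissible_iff)
    have "M ** (- N) = - (M ** N)" for M N :: "'a mat3"
      by (simp add: vec_eq_iff matrix_matrix_mult_def sum_negf)
    then show ?case
      using mstar_mult[OF v(1) eval_word_component[OF assms, of w]] v(2)
      by (simp add: Cons.IH eval_word_append mmult_mscale)
  qed
  then show ?thesis
    by - (rule additive_eq[where f = f],
      simp_all add: free_star_add eval_free_add mstar_add eval_free_single free_star_single
        mstar_mscale mult.commute)
qed

lemma T2_star_ideal_Id_A: "T2_star_ideal (Id_A :: 'k::field_char_0 free set)"
proof -
  have "two_sided_ideal (Id_A :: 'k free set)"
    by (simp add: two_sided_ideal_def Id_A_def eval_free_add eval_free_mult)
  moreover have "\<phi> f \<in> Id_A" if \<phi>: "graded_star_endo \<phi>" and f: "f \<in> Id_A" for \<phi> and f :: "'k free"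
  proof -
    have "eval_free \<rho> (\<phi> f) = 0" if \<rho>: "admissible \<rho>" for \<rho>
    proof -
      define \<rho>' where "\<rho>' v = eval_free \<rho> (\<phi> (gen v))" for v
      interpret \<phi>: Vector_Spaces.linear free_scale free_scale \<phi>
        using \<phi> by (simp add: graded_star_endo_def)
      have hom: "homog b (\<phi> h)" if "homog b h" for b h
        using \<phi> that by (cases b) (auto simp: graded_star_endo_def image_subset_iff
          free_even_iff free_odd_iff)
      have "mstar (\<rho>' v) = (if is_skew v then - \<rho>' v else \<rho>' v)" for v
      proof -
        have "mstar (\<rho>' v) = eval_free \<rho> (\<phi> (free_star (gen v)))"
          using \<phi> by (simp add: \<rho>'_def graded_star_endo_def eval_free_star[OF \<rho>])
        then show ?thesis
          using eval_free_diff[of \<rho> 0] by (simp add: free_star_gen \<phi>.neg \<rho>'_def)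
      qed
      then have \<rho>': "admissible \<rho>'"
        using eval_free_component[OF \<rho> hom[OF homog_gen]] by (simp add: admissible_iff \<rho>'_def)
      have word: "eval_free \<rho> (\<phi> (mon w)) = eval_word \<rho>' w" for w
      proof (induction w)
        case Nil
        show ?case
          using \<phi> eval_free_single[of \<rho> "[]" 1] by (simp add: graded_star_endo_def flip: mon_def)
      next
        case (Cons v w)
        then show ?case using \<phi> by (simp add: mon_Cons graded_star_endo_def eval_free_mult \<rho>'_def)
      qed
      have "eval_free \<rho> (\<phi> f) = eval_free \<rho>' f"
      proof (rule additive_eq[where f = f])
        show "eval_free \<rho> (\<phi> (Poly_Mapping.single w c)) = eval_free \<rho>' (Poly_Mapping.single w c)" for w c
          unfolding eval_free_single single_eq_scale_mon \<phi>.scale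
          by (simp add: eval_free_scale word eval_free_single flip: single_eq_scale_mon)
      qed (simp_all add: \<phi>.add eval_free_add)
      then show ?thesis using f \<rho>' by (simp add: Id_A_def)
    qed
    then show ?thesis by (simp add: Id_A_def)
  qed
  ultimately show ?thesis by (auto simp: T2_star_ideal_def)
qed

lemma generators_subset_Id_A: "(generators :: 'k::field_char_0 free set) \<subseteq> Id_A"
proof
  fix f :: "'k free"
  assume f: "f \<in> generators"
  show "f \<in> Id_A"
    unfolding Id_A_def
  proof (intro CollectI allI impI)
    fix \<rho> :: "var \<Rightarrow> 'k mat3"
    assume "admissible \<rho>"
    note \<rho> = admissible_cases[OF this]
    obtain d1 g1 c1 d2 g2 c2 where y: "\<rho> (Yp 1) = upper d1 g1 0 0 c1" "\<rho> (Yp 2) = upper d2 g2 0 0 c2"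
      using \<rho>(1) by metis
    obtain a1 a2 a3 b1 b2 b3 where z: "\<rho> (Zp 1) = upper 0 0 a1 a1 0" "\<rho> (Zp 2) = upper 0 0 a2 a2 0"
        "\<rho> (Zp 3) = upper 0 0 a3 a3 0" "\<rho> (Zm 1) = upper 0 0 b1 (- b1) 0"
        "\<rho> (Zm 2) = upper 0 0 b2 (- b2) 0" "\<rho> (Zm 3) = upper 0 0 b3 (- b3) 0"
      using \<rho>(3,4) by metis
    show "eval_free \<rho> f = 0"
      using f unfolding generators_def commutator_def jordan_def
      by (elim UnE insertE CollectE exE conjE emptyE; hypsubst_thin)
        (simp_all add: eval_free_add eval_free_diff eval_free_mult \<rho>(2) y[unfolded One_nat_def]
          z[unfolded One_nat_def] upper_mult upper_add upper_diff upper_zero upper_eq_iff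
          mult.left_commute mult.commute)
  qed
qed

section \<open>Consequences of the generating identities\<close>

definition sym_even :: "'k::field_char_0 free \<Rightarrow> bool" where
  "sym_even h \<longleftrightarrow> homog False h \<and> free_star h = h"

text \<open>The sign with which the \<open>e\<^sub>2\<^sub>3\<close> entry enters the value \<open>e\<^sub>1\<^sub>2 \<plusminus> e\<^sub>2\<^sub>3\<close>
  of an odd variable.\<close>

definition odd_sign :: "var \<Rightarrow> 'k::field_char_0" where
  "odd_sign z = (if is_skew z then - 1 else 1)"

abbreviation ys :: "nat list \<Rightarrow> var list" where
  "ys u \<equiv> map Yp u"

lemma star_compatible_gen: "star_compatible gen"
  by (simp add: star_compatible_def homog_gen free_star_gen)

lemma star_compatible_update_gen:
  "star_compatible \<sigma> \<Longrightarrow> is_odd v = is_odd w \<Longrightarrow> is_skew v = is_skew w \<Longrightarrow>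
     star_compatible (\<sigma>(v := gen w))"
  using homog_gen[of w] by (auto simp: star_compatible_def free_star_gen)

lemma star_compatible_update_sym_even:
  "star_compatible \<sigma> \<Longrightarrow> sym_even h \<Longrightarrow> star_compatible (\<sigma>(Yp i := h))"
  by (auto simp: star_compatible_def sym_even_def)

lemma sym_even_symmetrization:
  "sym_even (free_scale (1 / 2) (mon (ys u) + mon (ys (rev u))) :: 'k::field_char_0 free)"
proof -
  have e: "filter is_odd (ys u) = []" "filter is_skew (ys u) = []" for u
    by (induction u) simp_all
  have "homog False (mon (ys u) :: 'k free)"
    "free_star (mon (ys u)) = (mon (ys (rev u)) :: 'k free)" for u
    unfolding mon_def by (simp_all add: homog_single free_star_single e rev_map)
  then show ?thesis
    by (simp add: sym_even_def homog_scale homog_add free_star_scale free_star_add add.commute)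
qed

locale ideal_above_generators =
  fixes I :: "'k::field_char_0 free set"
  assumes T2: "T2_star_ideal I"
    and generators_mem: "generators \<subseteq> I"
begin

definition congr :: "'k free \<Rightarrow> 'k free \<Rightarrow> bool" (infix "\<simeq>" 50) where
  "f \<simeq> g \<longleftrightarrow> f - g \<in> I"

lemma
  shows zero_mem: "0 \<in> I"
    and add_mem: "f \<in> I \<Longrightarrow> g \<in> I \<Longrightarrow> f + g \<in> I"
    and mult_left_mem: "f \<in> I \<Longrightarrow> h * f \<in> I"
    and mult_right_mem: "f \<in> I \<Longrightarrow> f * h \<in> I"
  using T2 by (auto simp: T2_star_ideal_def two_sided_ideal_def)

lemma scale_mem: "f \<in> I \<Longrightarrow> free_scale c f \<in> I"
  by (simp add: free_scale_def mult_left_mem)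

lemma minus_mem: "f \<in> I \<Longrightarrow> - f \<in> I"
  using mult_left_mem[of f "-1"] by simp

lemma sum_mem: "(\<And>x. x \<in> S \<Longrightarrow> h x \<in> I) \<Longrightarrow> sum h S \<in> I"
  by (induction S rule: infinite_finite_induct) (simp_all add: zero_mem add_mem)

lemma subst_mem: "star_compatible \<sigma> \<Longrightarrow> f \<in> I \<Longrightarrow> subst \<sigma> f \<in> I"
  using T2 graded_star_endo_subst[of \<sigma>] unfolding T2_star_ideal_def by blast

lemma congr_refl [simp]: "f \<simeq> f"
  by (simp add: congr_def zero_mem)

lemma congr_sym: "f \<simeq> g \<Longrightarrow> g \<simeq> f"
  using minus_mem[of "f - g"] by (simp add: congr_def)

lemma congr_trans [trans]: "f \<simeq> g \<Longrightarrow> g \<simeq> h \<Longrightarrow> f \<simeq> h"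
  using add_mem[of "f - g" "g - h"] by (simp add: congr_def)

lemma congr_add: "f \<simeq> f' \<Longrightarrow> g \<simeq> g' \<Longrightarrow> f + g \<simeq> f' + g'"
  using add_mem[of "f - f'" "g - g'"] by (simp add: congr_def algebra_simps)

lemma congr_mult:
  assumes "f \<simeq> f'" "g \<simeq> g'"
  shows "f * g \<simeq> f' * g'"
  using add_mem[OF mult_right_mem[of "f - f'" g] mult_left_mem[of "g - g'" f']] assms
  by (simp add: congr_def algebra_simps)

lemma congr_mult_left: "f \<simeq> f' \<Longrightarrow> h * f \<simeq> h * f'"
  by (simp add: congr_mult)

lemma congr_mult_right: "f \<simeq> f' \<Longrightarrow> f * h \<simeq> f' * h"
  by (simp add: congr_mult)

lemma congr_scale: "f \<simeq> g \<Longrightarrow> free_scale c f \<simeq> free_scale c g"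
  using scale_mem[of "f - g" c] by (simp add: congr_def free.scale_right_diff_distrib)

lemma congr_mem: "f \<simeq> g \<Longrightarrow> g \<in> I \<Longrightarrow> f \<in> I"
  using add_mem[of "f - g" g] by (simp add: congr_def)

lemma skew_even_mem: "ym i \<in> I"
proof -
  have "ym 1 \<in> I" using generators_mem by (auto simp: generators_def)
  from subst_mem[OF star_compatible_update_gen[OF star_compatible_gen, of "Ym 1" "Ym i"] this]
  show ?thesis by simp
qed

lemma y_commute: "yp i * yp j \<simeq> yp j * yp i"
proof -
  let ?\<sigma> = "gen(Yp 1 := yp i, Yp 2 := yp j)"
  have "star_compatible ?\<sigma>"
    by (intro star_compatible_update_gen star_compatible_gen) simp_all
  moreover have "commutator (yp 1) (yp 2) \<in> I"
    using generators_mem by (auto simp: generators_def)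
  ultimately have "subst ?\<sigma> (commutator (yp 1) (yp 2)) \<in> I" by (rule subst_mem)
  then show ?thesis by (simp add: congr_def commutator_def subst_diff subst_mult)
qed

lemma commutes_with_y_word:
  assumes "\<And>i. yp i * f \<simeq> f * yp i"
  shows "mon (ys u) * f \<simeq> f * mon (ys u)"
proof (induction u)
  case (Cons i u)
  have "mon (ys (i # u)) * f = yp i * (mon (ys u) * f)"
    by (simp add: mon_Cons mult.assoc)
  also have "\<dots> \<simeq> yp i * (f * mon (ys u))"
    by (rule congr_mult_left[OF Cons.IH])
  also have "\<dots> = (yp i * f) * mon (ys u)"
    by (simp add: mult.assoc)
  also have "\<dots> \<simeq> (f * yp i) * mon (ys u)"
    by (rule congr_mult_right[OF assms])
  also have "\<dots> = f * mon (ys (i # u))"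
    by (simp add: mon_Cons mult.assoc)
  finally show ?case .
qed simp

lemma y_word_perm: "mset u = mset u' \<Longrightarrow> mon (ys u) \<simeq> mon (ys u')"
proof (induction u arbitrary: u')
  case (Cons i u)
  then have "i \<in> set u'" by (metis list.set_intros(1) set_mset_mset)
  then obtain v v' where u': "u' = v @ i # v'" by (meson split_list)
  with Cons.prems have "mset u = mset (v @ v')" by simp
  then have "mon (ys (i # u)) \<simeq> yp i * mon (ys (v @ v'))"
    unfolding list.map mon_Cons by (rule congr_mult_left[OF Cons.IH])
  also have "\<dots> = (yp i * mon (ys v)) * mon (ys v')"
    by (simp add: mon_append mult.assoc)
  also have "\<dots> \<simeq> (mon (ys v) * yp i) * mon (ys v')"
    by (intro congr_mult_right congr_sym[OF commutes_with_y_word] y_commute)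
  also have "\<dots> = mon (ys u')"
    by (simp add: u' mon_append mon_Cons mult.assoc)
  finally show ?case .
qed simp

text \<open>Only symmetric even elements may be substituted for \<open>y\<^sub>i\<^sup>+\<close>, and a product of commuting
  symmetric variables need not be symmetric in the free algebra. Its symmetrization is, and differs from
  it by an element of \<open>I\<close>.\<close>

lemma y_word_symmetric:
  obtains h where "sym_even h" "h \<simeq> mon (ys u)"
proof
  let ?h = "free_scale (1 / 2) (mon (ys u) + mon (ys (rev u)))"
  show "sym_even ?h" by (rule sym_even_symmetrization)
  have "?h \<simeq> free_scale (1 / 2) (mon (ys u) + mon (ys u))"
    by (intro congr_scale congr_add congr_refl y_word_perm) simp
  also have "\<dots> = mon (ys u)"
    by (simp add: free.scale_right_distrib flip: free.scale_left_distrib)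
  finally show "?h \<simeq> mon (ys u)" .
qed

lemma odd_pair_central_sym_even:
  assumes z: "is_odd z" "is_odd z'" and h: "sym_even h"
  shows "yp i * (gen z * h * gen z') \<simeq> gen z * h * gen z' * yp i"
proof -
  \<comment> \<open>The letters of the generator that have the same symmetry as \<open>z\<close> and \<open>z'\<close>.\<close>
  define w where "w = (if is_skew z then Zm 1 else Zp 1)"
  define w' where "w' = (if is_skew z' then Zm 2 else Zp 2)"
  let ?\<sigma> = "gen(w := gen z, w' := gen z', Yp 1 := yp i, Yp 2 := h)"
  have "star_compatible ?\<sigma>"
    using z h
    by (intro star_compatible_update_gen star_compatible_gen star_compatible_update_sym_even)
      (auto simp: w_def w'_def)
  moreover have "commutator (yp 1) (gen w * yp 2 * gen w') \<in> I"
    using generators_mem by (force simp: generators_def w_def w'_def)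
  ultimately have "subst ?\<sigma> (commutator (yp 1) (gen w * yp 2 * gen w')) \<in> I" by (rule subst_mem)
  then show ?thesis
    by (simp add: congr_def commutator_def subst_diff subst_mult w_def w'_def split: if_splits)
qed

text \<open>The last three generators in one formula: in \<open>A\<close>, the value of \<open>z h z'\<close> is a multiple of
  \<open>e\<^sub>1\<^sub>3\<close>, symmetric in \<open>z\<close> and \<open>z'\<close> apart from the sign of the
  \<open>e\<^sub>2\<^sub>3\<close> entry of the right-hand factor.\<close>

lemma odd_pair_swap_sym_even:
  assumes z: "is_odd z" "is_odd z'" and h: "sym_even h"
  shows "free_scale (odd_sign z') (gen z * h * gen z') \<simeq>
    free_scale (odd_sign z) (gen z' * h * gen z)"
proof -
  have *: "subst (gen(w := gen z, w' := gen z', Yp 1 := h)) f \<in> I"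
    if "f \<in> generators" "is_odd w" "is_odd w'" "is_skew w = is_skew z" "is_skew w' = is_skew z'"
      "is_odd z" "is_odd z'" for f w w' z z'
    using that generators_mem h
    by (intro subst_mem star_compatible_update_gen star_compatible_gen
        star_compatible_update_sym_even) auto
  have mixed: "gen z * h * gen z' + gen z' * h * gen z \<in> I" if "is_odd z" "is_odd z'"
    "is_skew z" "\<not> is_skew z'" for z z'
    using *[of "zm 1 * yp 1 * zp 2 + zp 2 * yp 1 * zm 1" "Zm 1" "Zp 2" z z'] that
    by (simp add: generators_def subst_add subst_mult)
  consider "\<not> is_skew z" "\<not> is_skew z'" | "is_skew z" "is_skew z'" | "is_skew z" "\<not> is_skew z'"
    | "\<not> is_skew z" "is_skew z'" by blast
  then show ?thesis
  proof cases
    case 1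
    then show ?thesis
      using *[of "zp 1 * yp 1 * zp 2 - zp 2 * yp 1 * zp 1" "Zp 1" "Zp 2" z z'] z
      by (simp add: generators_def subst_diff subst_mult congr_def odd_sign_def)
  next
    case 2
    then have "gen z * h * gen z' - gen z' * h * gen z \<in> I"
      using *[of "zm 1 * yp 1 * zm 2 - zm 2 * yp 1 * zm 1" "Zm 1" "Zm 2" z z'] z
      by (simp add: generators_def subst_diff subst_mult)
    from minus_mem[OF this] 2 show ?thesis
      by (simp add: congr_def odd_sign_def free.scale_minus_left)
  next
    case 3
    with mixed[of z z'] z show ?thesis
      by (simp add: congr_def odd_sign_def free.scale_minus_left)
  next
    case 4
    with minus_mem[OF mixed[of z' z]] z show ?thesis
      by (simp add: congr_def odd_sign_def free.scale_minus_left algebra_simps)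
  qed
qed

lemma odd_pair_central:
  assumes "is_odd z" "is_odd z'"
  shows "mon (ys u) * (gen z * mon (ys v) * gen z') \<simeq> gen z * mon (ys v) * gen z' * mon (ys u)"
proof (rule commutes_with_y_word)
  fix i
  obtain h where h: "sym_even h" "h \<simeq> mon (ys v)" by (rule y_word_symmetric)
  have eq: "gen z * h * gen z' \<simeq> gen z * mon (ys v) * gen z'"
    by (intro congr_mult congr_refl h)
  have "yp i * (gen z * mon (ys v) * gen z') \<simeq> yp i * (gen z * h * gen z')"
    by (rule congr_mult_left[OF congr_sym[OF eq]])
  also have "\<dots> \<simeq> gen z * h * gen z' * yp i"
    by (rule odd_pair_central_sym_even[OF assms h(1)])
  also have "\<dots> \<simeq> gen z * mon (ys v) * gen z' * yp i"
    by (rule congr_mult_right[OF eq])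
  finally show "yp i * (gen z * mon (ys v) * gen z') \<simeq> gen z * mon (ys v) * gen z' * yp i" .
qed

lemma odd_pair_swap:
  assumes "is_odd z" "is_odd z'"
  shows "free_scale (odd_sign z') (gen z * mon (ys v) * gen z') \<simeq>
    free_scale (odd_sign z) (gen z' * mon (ys v) * gen z)"
proof -
  obtain h where h: "sym_even h" "h \<simeq> mon (ys v)" by (rule y_word_symmetric)
  have eq: "gen z * h * gen z' \<simeq> gen z * mon (ys v) * gen z'" for z z'
    by (intro congr_mult congr_refl h)
  have "free_scale (odd_sign z') (gen z * mon (ys v) * gen z') \<simeq>
      free_scale (odd_sign z') (gen z * h * gen z')"
    by (rule congr_scale[OF congr_sym[OF eq]])
  also have "\<dots> \<simeq> free_scale (odd_sign z) (gen z' * h * gen z)"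
    by (rule odd_pair_swap_sym_even[OF assms h(1)])
  also have "\<dots> \<simeq> free_scale (odd_sign z) (gen z' * mon (ys v) * gen z)"
    by (rule congr_scale[OF eq])
  finally show ?thesis .
qed

lemma odd_triple_mem:
  assumes z: "is_odd z1" "is_odd z2" "is_odd z3"
  shows "gen z1 * gen z2 * gen z3 \<in> I"
proof -
  define w where "w z i = (if is_skew z then Zm i else Zp i)" for z i
  let ?\<sigma> = "(gen :: var \<Rightarrow> 'k free)(w z1 1 := gen z1, w z2 2 := gen z2, w z3 3 := gen z3)"
  have "star_compatible ?\<sigma>"
    using z by (intro star_compatible_update_gen star_compatible_gen) (auto simp: w_def)
  moreover have "gen (w z1 1) * gen (w z2 2) * gen (w z3 3) \<in> I"
  proof -
    have "gen (w z1 1) \<in> {zp 1, zm 1 :: 'k free}" "gen (w z2 2) \<in> {zp 2, zm 2 :: 'k free}"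
      "gen (w z3 3) \<in> {zp 3, zm 3 :: 'k free}"
      by (simp_all add: w_def)
    then have "gen (w z1 1) * gen (w z2 2) * gen (w z3 3) \<in> (generators :: 'k free set)"
      unfolding generators_def by (intro UnI1[OF UnI2] CollectI exI conjI) (rule refl)
    then show ?thesis using generators_mem by (rule subsetD[rotated])
  qed
  ultimately have "subst ?\<sigma> (gen (w z1 1) * gen (w z2 2) * gen (w z3 3)) \<in> I"
    by (rule subst_mem)
  moreover have "?\<sigma> (w z1 1) = gen z1" "?\<sigma> (w z2 2) = gen z2" "?\<sigma> (w z3 3) = gen z3"
    by (auto simp: w_def)
  ultimately show ?thesis by (simp only: subst_mult subst_gen)
qed

text \<open>Both even words can be moved out: \<open>v\<close> to the left of the central factor \<open>z1 u z2\<close>, and then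
  \<open>u\<close> to the right of the central factor \<open>z2 z3\<close>. This leaves \<open>v z1 z2 z3 u\<close>.\<close>

lemma spread_odd_triple_mem:
  assumes z: "is_odd z1" "is_odd z2" "is_odd z3"
  shows "gen z1 * mon (ys u) * gen z2 * mon (ys v) * gen z3 \<in> I"
proof (rule congr_mem)
  have "gen z1 * mon (ys u) * gen z2 * mon (ys v) * gen z3 \<simeq>
      (mon (ys v) * (gen z1 * mon (ys u) * gen z2)) * gen z3"
    by (intro congr_mult_right congr_sym[OF odd_pair_central] z)
  also have "\<dots> = mon (ys v) * gen z1 * (mon (ys u) * (gen z2 * mon (ys []) * gen z3))"
    by (simp add: mult.assoc)
  also have "\<dots> \<simeq> mon (ys v) * gen z1 * (gen z2 * mon (ys []) * gen z3 * mon (ys u))"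
    by (intro congr_mult_left odd_pair_central z)
  also have "\<dots> = mon (ys v) * (gen z1 * gen z2 * gen z3) * mon (ys u)"
    by (simp add: mult.assoc)
  finally show "gen z1 * mon (ys u) * gen z2 * mon (ys v) * gen z3 \<simeq>
      mon (ys v) * (gen z1 * gen z2 * gen z3) * mon (ys u)" .
  show "mon (ys v) * (gen z1 * gen z2 * gen z3) * mon (ys u) \<in> I"
    by (intro mult_left_mem mult_right_mem odd_triple_mem z)
qed

end

section \<open>Normal words\<close>

text \<open>\<open>Outer i\<close> and \<open>Inner i\<close> stand for the parameters \<open>d\<^sub>i\<close> and \<open>g\<^sub>i\<close> of the value
  \<open>diag(d\<^sub>i, g\<^sub>i, d\<^sub>i)\<close> of \<open>y\<^sub>i\<^sup>+\<close>, and \<open>Odd z\<close> for the scalar in the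
  value of the odd variable \<open>z\<close>.\<close>

datatype weight = Outer nat | Inner nat | Odd var

definition weights :: "nat multiset \<Rightarrow> nat multiset \<Rightarrow> var multiset \<Rightarrow> weight multiset" where
  "weights A B C = image_mset Outer A + image_mset Inner B + image_mset Odd C"

lemma weights_eq_iff: "weights A B C = weights A' B' C' \<longleftrightarrow> A = A' \<and> B = B' \<and> C = C'"
proof -
  have "image_mset (\<lambda>x. case x of Outer i \<Rightarrow> i) {#x \<in># weights A B C. \<exists>i. x = Outer i#} = A"
    "image_mset (\<lambda>x. case x of Inner i \<Rightarrow> i) {#x \<in># weights A B C. \<exists>i. x = Inner i#} = B"
    "image_mset (\<lambda>x. case x of Odd z \<Rightarrow> z) {#x \<in># weights A B C. \<exists>z. x = Odd z#} = C" for A B C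
    by (simp_all add: weights_def filter_mset_image_mset multiset.map_comp o_def)
  then show ?thesis by metis
qed

text \<open>In \<open>normal w s M\<close> the value of \<open>w\<close> has first row with the single nonzero entry \<open>s\<close> times
  the product of the parameters in \<open>M\<close>. A path through the matrix starts in row 1, moves to row 2
  at the first odd letter and to row 3 at the second. So even letters preceded by exactly one odd
  letter pick up the middle diagonal entry, all others the outer one, and a second odd letter contributes its
  \<open>e\<^sub>2\<^sub>3\<close> entry, whence the sign.\<close>

inductive normal :: "var list \<Rightarrow> 'k::field_char_0 \<Rightarrow> weight multiset \<Rightarrow> bool" where
  none: "normal (ys u) 1 (weights (mset u) {#} {#})"
| one: "is_odd z \<Longrightarrow> normal (ys u @ z # ys v) 1 (weights (mset u) (mset v) {#z#})"
| two: "is_odd z \<Longrightarrow> is_odd z' \<Longrightarrow> normal (ys u @ z # ys v @ z' # ys x) (odd_sign z')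
    (weights (mset (u @ x)) (mset v) {#z, z'#})"

lemma odd_sign_square [simp]: "odd_sign z * odd_sign z = 1"
  by (simp add: odd_sign_def)

lemma normal_sign: "normal w s M \<Longrightarrow> s * s = 1"
  by (induction rule: normal.induct) simp_all

lemma split_at_first_odd:
  assumes "\<And>i. Ym i \<notin> set w"
  obtains u where "w = ys u" | u z v where "w = ys u @ z # v" "is_odd z"
proof -
  have "(\<exists>u. w = ys u) \<or> (\<exists>u z v. w = ys u @ z # v \<and> is_odd z)"
    using assms
  proof (induction w)
    case (Cons a w)
    show ?case
    proof (cases "is_odd a")
      case True
      then show ?thesis by (metis append_Nil list.map(1))
    next
      case False
      with Cons.prems obtain i where "a = Yp i" by (cases a) auto
      with Cons show ?thesis by (metis append_Cons list.map(2) list.set_intros(2))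
    qed
  qed simp
  with that show thesis by blast
qed

context ideal_above_generators
begin

lemma normal_or_mem: "mon w \<in> I \<or> (\<exists>s M. normal w (s::'k) M)"
proof (cases "\<exists>i. Ym i \<in> set w")
  case True
  then obtain i u v where "w = u @ Ym i # v" by (meson split_list)
  then have "mon w \<in> I"
    by (simp add: mon_append mon_Cons mult_left_mem mult_right_mem skew_even_mem)
  then show ?thesis ..
next
  case False
  then have "\<And>i. Ym i \<notin> set w" by blast
  then show ?thesis
  proof (cases rule: split_at_first_odd)
    case (1 u)
    then show ?thesis by (blast intro: normal.none)
  next
    case w: (2 u z1 w')
    with False have "\<And>i. Ym i \<notin> set w'" by auto
    then show ?thesis
    proof (cases rule: split_at_first_odd)
      case (1 v)
      then show ?thesis using w by (blast intro: normal.one)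
    next
      case w': (2 v z2 w'')
      with False w have "\<And>i. Ym i \<notin> set w''" by auto
      then show ?thesis
      proof (cases rule: split_at_first_odd)
        case (1 x)
        then show ?thesis using w w' by (blast intro: normal.two)
      next
        case w'': (2 x z3 w''')
        have "(mon w :: 'k free) = mon (ys u) * (gen z1 * mon (ys v) * gen z2 * mon (ys x) * gen z3) * mon w'''"
          by (simp add: w w' w'' mon_append mon_Cons mult.assoc)
        then have "mon w \<in> I"
          using w(2) w'(2) w''(2)
          by (simp add: mult_left_mem mult_right_mem spread_odd_triple_mem)
        then show ?thesis ..
      qed
    qed
  qed
qed

lemma two_odd_standard:
  assumes "is_odd z" "is_odd z'"
  shows "mon (ys u @ z # ys v @ z' # ys x) \<simeq> mon (ys (u @ x)) * (gen z * mon (ys v) * gen z')"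
proof -
  have "(mon (ys u @ z # ys v @ z' # ys x) :: 'k free) =
      mon (ys u) * (gen z * mon (ys v) * gen z' * mon (ys x))"
    by (simp add: mon_append mon_Cons mult.assoc)
  also have "\<dots> \<simeq> mon (ys u) * (mon (ys x) * (gen z * mon (ys v) * gen z'))"
    by (intro congr_mult_left congr_sym[OF odd_pair_central] assms)
  also have "\<dots> = mon (ys (u @ x)) * (gen z * mon (ys v) * gen z')"
    by (simp add: mon_append mult.assoc)
  finally show ?thesis .
qed

text \<open>With the outer letters collected on the left, two normal words with the same weights differ by
  permutations of even letters inside \<open>u x\<close> and inside \<open>v\<close>, and possibly by exchanging the two
  odd letters; the sign in \<open>odd_pair_swap\<close> is the quotient of the signs of the two words.\<close>

lemma normal_congr:
  assumes "normal w s M" "normal w' s' M"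
  shows "free_scale s (mon w) \<simeq> free_scale s' (mon w')"
  using assms(1)
proof cases
  case (none u)
  with assms(2) obtain u' where "w' = ys u'" "s' = 1" "mset u = mset u'"
    by cases (auto simp: weights_eq_iff)
  with none show ?thesis by (simp add: y_word_perm)
next
  case (one z u v)
  with assms(2) obtain u' v' where *: "w' = ys u' @ z # ys v'" "s' = 1"
    "mset u = mset u'" "mset v = mset v'"
    by cases (auto simp: weights_eq_iff)
  have "mon (ys u) * (gen z * mon (ys v)) \<simeq> mon (ys u') * (gen z * mon (ys v'))"
    by (intro congr_mult congr_refl y_word_perm *)
  with one * show ?thesis by (simp add: mon_append mon_Cons)
next
  case (two z z' u v x)
  with assms(2) obtain a a' u' v' x' where *: "w' = ys u' @ a # ys v' @ a' # ys x'"
    "s' = odd_sign a'" "mset (u @ x) = mset (u' @ x')" "mset v = mset v'"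
    "{#z, z'#} = {#a, a'#}" "is_odd a" "is_odd a'"
    by cases (auto simp: weights_eq_iff)
  let ?p = "\<lambda>z z'. gen z * mon (ys v') * gen z'"
  have swap: "free_scale (odd_sign z') (?p z z') \<simeq> free_scale (odd_sign a') (?p a a')"
  proof (cases "z = a")
    case True
    with *(5) show ?thesis by simp
  next
    case False
    with *(5) have "a = z'" "a' = z" by (auto simp: add_eq_conv_ex)
    with odd_pair_swap[OF two(4,5)] show ?thesis by simp
  qed
  have "free_scale s (mon w) \<simeq>
      free_scale s (mon (ys (u @ x)) * (gen z * mon (ys v) * gen z'))"
    unfolding two(1) by (intro congr_scale two_odd_standard two(4,5))
  also have "\<dots> \<simeq> free_scale s (mon (ys (u' @ x')) * ?p z z')"
    by (intro congr_scale congr_mult congr_refl y_word_perm *)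
  also have "\<dots> = mon (ys (u' @ x')) * free_scale (odd_sign z') (?p z z')"
    by (simp add: two(2) free_scale_mult_right)
  also have "\<dots> \<simeq> mon (ys (u' @ x')) * free_scale (odd_sign a') (?p a a')"
    by (rule congr_mult_left[OF swap])
  also have "\<dots> = free_scale s' (mon (ys (u' @ x')) * ?p a a')"
    by (simp add: *(2) free_scale_mult_right)
  also have "\<dots> \<simeq> free_scale s' (mon w')"
    unfolding *(1) by (intro congr_scale congr_sym[OF two_odd_standard] *)
  finally show ?thesis .
qed

end

section \<open>Separating normal words by evaluation\<close>

fun weight_eval :: "(weight \<Rightarrow> 'k::field_char_0) \<Rightarrow> var \<Rightarrow> 'k mat3" where
  "weight_eval p (Yp i) = upper (p (Outer i)) (p (Inner i)) 0 0 0"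
| "weight_eval p (Ym i) = 0"
| "weight_eval p (Zp i) = upper 0 0 (p (Odd (Zp i))) (p (Odd (Zp i))) 0"
| "weight_eval p (Zm i) = upper 0 0 (p (Odd (Zm i))) (- p (Odd (Zm i))) 0"

lemma admissible_weight_eval: "admissible (weight_eval p)"
  by (auto simp: admissible_def sym_A0_iff skew_part_A0 sym_A1_iff skew_A1_iff)

lemma weight_eval_odd:
  "is_odd z \<Longrightarrow> weight_eval p z = upper 0 0 (p (Odd z)) (odd_sign z * p (Odd z)) 0"
  by (cases z) (simp_all add: odd_sign_def)

lemma weight_eval_y_word:
  "eval_word (weight_eval p) (ys u) =
     upper (\<Prod>i\<in>#mset u. p (Outer i)) (\<Prod>i\<in>#mset u. p (Inner i)) 0 0 0"
  by (induction u) (simp_all add: upper_one upper_mult)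

text \<open>The position of the nonzero entry in the first row depends on the number of odd letters; summing
  the row treats the three shapes of normal words at once.\<close>

definition row_sum :: "'k::field_char_0 mat3 \<Rightarrow> 'k" where
  "row_sum M = M $ 1 $ 1 + M $ 1 $ 2 + M $ 1 $ 3"

lemma row_sum_upper: "row_sum (upper d g a b c) = d + a + c"
  by (simp add: row_sum_def upper_def)

lemma row_sum_zero: "row_sum 0 = 0"
  by (simp add: row_sum_def)

lemma row_sum_normal:
  "normal w s M \<Longrightarrow> row_sum (eval_word (weight_eval p) w) = s * (\<Prod>x\<in>#M. p x)"
  by (induction rule: normal.induct)
    (simp_all add: eval_word_append weight_eval_y_word weight_eval_odd upper_mult row_sum_upper
      weights_def multiset.map_comp o_def ac_simps)

lemma row_sum_eval_free:
  "row_sum (eval_free \<rho> f) =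
     (\<Sum>w\<in>Poly_Mapping.keys f. Poly_Mapping.lookup f w * row_sum (eval_word \<rho> w))"
  by (simp add: eval_free_def row_sum_def mscale_def sum.distrib distrib_left)

text \<open>The hypothesis says that \<open>w \<mapsto> c w\<close> annihilates every polynomial in \<open>x w\<close>; apply it to a
  polynomial that vanishes at all values of \<open>x\<close> except \<open>a\<close>.\<close>

lemma vanishing_power_sums:
  fixes c x :: "'a \<Rightarrow> 'k::field"
  assumes "finite S" and power: "\<And>k. (\<Sum>w\<in>S. c w * x w ^ k) = 0"
  shows "(\<Sum>w | w \<in> S \<and> x w = a. c w) = 0"
proof -
  define q where "q = (\<Prod>b\<in>x ` S - {a}. [:- b, 1:])"
  have q: "poly q (x w) = (if x w = a then poly q a else 0)" if "w \<in> S" for w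
    using that assms(1) by (auto simp: q_def poly_prod)
  have "0 = (\<Sum>k\<le>degree q. coeff q k * (\<Sum>w\<in>S. c w * x w ^ k))"
    by (simp add: power)
  also have "\<dots> = (\<Sum>w\<in>S. c w * poly q (x w))"
    by (simp add: poly_altdef sum_distrib_left sum.swap[of _ S] ac_simps)
  also have "\<dots> = (\<Sum>w\<in>S. if x w = a then c w * poly q a else 0)"
    by (intro sum.cong) (auto simp: q)
  also have "\<dots> = poly q a * (\<Sum>w | w \<in> S \<and> x w = a. c w)"
    using assms(1) by (auto simp: sum.inter_filter sum_distrib_left mult.commute intro!: sum.cong)
  finally show ?thesis using assms(1) by (auto simp: q_def poly_prod)
qed

instance var :: countable by countable_datatype
instance weight :: countable by countable_datatype

text \<open>Assign distinct primes to the weights; unique factorization recovers the multiset from the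
  product.\<close>

lemma separating_weight:
  obtains \<pi> :: "weight \<Rightarrow> nat" where "inj (\<lambda>M. \<Prod>x\<in>#M. \<pi> x)"
proof
  define \<pi> where "\<pi> (x::weight) = enumerate {p::nat. prime p} (to_nat x)" for x
  have "strict_mono (enumerate {p::nat. prime p})"
    by (intro strict_mono_enumerate primes_infinite)
  then have "inj \<pi>"
    unfolding \<pi>_def by (metis inj_compose[unfolded o_def] inj_to_nat strict_mono_imp_inj_on)
  have "prime (\<pi> x)" for x
    using enumerate_in_set[OF primes_infinite] by (simp add: \<pi>_def)
  then have "prime_factorization (\<Prod>x\<in>#M. \<pi> x) = image_mset \<pi> M" for M
    by (intro prime_factorization_prod_mset_primes) auto
  then show "inj (\<lambda>M. \<Prod>x\<in>#M. \<pi> x)"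
    using multiset.inj_map[OF \<open>inj \<pi>\<close>] by (metis (no_types, lifting) injD injI)
qed

lemma (in ideal_above_generators) Id_A_subset: "Id_A \<subseteq> I"
proof
  fix f :: "'k free"
  assume f: "f \<in> Id_A"
  interpret A: ideal_above_generators "Id_A :: 'k free set"
    by (rule ideal_above_generators.intro[OF T2_star_ideal_Id_A generators_subset_Id_A])
  define c where "c w = Poly_Mapping.lookup f w" for w
  define S where "S = {w \<in> Poly_Mapping.keys f. \<exists>s M. normal w (s::'k) M}"
  have "\<exists>s M. normal w (s::'k) M" if "w \<in> S" for w
    using that by (simp add: S_def)
  then obtain s :: "var list \<Rightarrow> 'k" and M where n: "\<And>w. w \<in> S \<Longrightarrow> normal w (s w) (M w)"
    by metis
  obtain \<pi> :: "weight \<Rightarrow> nat" where \<pi>: "inj (\<lambda>M. \<Prod>x\<in>#M. \<pi> x)"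
    by (rule separating_weight)
  define val :: "var list \<Rightarrow> 'k" where "val w = of_nat (\<Prod>x\<in>#M w. \<pi> x)" for w
  have S: "finite S" "S \<subseteq> Poly_Mapping.keys f"
    by (simp_all add: S_def)
  have sum_f: "f = (\<Sum>w\<in>Poly_Mapping.keys f. free_scale (c w) (mon w))"
    by (intro poly_mapping_eqI) (simp add: lookup_sum c_def mon_def lookup_single when_def in_keys_iff)

  have "(\<Sum>w\<in>S. c w * s w * val w ^ k) = 0" for k
  proof -
    define \<rho> :: "var \<Rightarrow> 'k mat3" where "\<rho> = weight_eval (\<lambda>x. of_nat (\<pi> x) ^ k)"
    have \<rho>: "admissible \<rho>" by (simp add: \<rho>_def admissible_weight_eval)
    \<comment> \<open>The classification of words also applies to the ideal \<open>Id_A\<close> itself, so words that are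
      not normal evaluate to zero.\<close>
    have dead: "row_sum (eval_word \<rho> w) = 0" if "w \<in> Poly_Mapping.keys f - S" for w
    proof -
      have "mon w \<in> (Id_A :: 'k free set)"
        using that A.normal_or_mem[of w] by (auto simp: S_def)
      then have "eval_word \<rho> w = 0"
        using \<rho> by (auto simp: Id_A_def mon_def eval_free_single)
      then show ?thesis by (simp add: row_sum_zero)
    qed
    have live: "row_sum (eval_word \<rho> w) = s w * val w ^ k" if "w \<in> S" for w
    proof -
      have "(\<Prod>x\<in>#N. of_nat (\<pi> x) ^ k) = (of_nat (\<Prod>x\<in>#N. \<pi> x) :: 'k) ^ k" for N
        by (induction N) (simp_all add: power_mult_distrib)
      then show ?thesis by (simp add: \<rho>_def val_def row_sum_normal[OF n[OF that]])
    qed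
    have "0 = row_sum (eval_free \<rho> f)"
      using f \<rho> by (simp add: Id_A_def row_sum_zero)
    also have "\<dots> = (\<Sum>w\<in>S. c w * row_sum (eval_word \<rho> w))"
      unfolding row_sum_eval_free c_def[symmetric]
      by (rule sum.mono_neutral_right) (use S dead in auto)
    also have "\<dots> = (\<Sum>w\<in>S. c w * s w * val w ^ k)"
      by (simp add: live mult.assoc)
    finally show ?thesis by simp
  qed
  then have fibre: "(\<Sum>w | w \<in> S \<and> val w = a. c w * s w) = 0" for a
    by (rule vanishing_power_sums[OF S(1)])

  \<comment> \<open>Compare all words of one fibre with a fixed one; what remains is the fibre sum of the signed
    coefficients.\<close>
  have "(\<Sum>w | w \<in> S \<and> val w = a. free_scale (c w) (mon w)) \<in> I" if "a \<in> val ` S" for a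
  proof -
    from that obtain w0 where w0: "w0 \<in> S" "val w0 = a" by blast
    let ?S = "{w \<in> S. val w = a}" and ?g = "free_scale (s w0) (mon w0)"
    have "free_scale (c w * s w) (free_scale (s w) (mon w) - ?g) \<in> I" if "w \<in> ?S" for w
    proof -
      have "M w = M w0"
        using that w0 \<pi> by (auto simp: val_def of_nat_eq_iff dest: injD)
      then have "normal w (s w) (M w)" "normal w0 (s w0) (M w)"
        using n[of w] n[of w0] that w0 by auto
      then show ?thesis by (intro scale_mem normal_congr[unfolded congr_def])
    qed
    then have "(\<Sum>w\<in>?S. free_scale (c w * s w) (free_scale (s w) (mon w) - ?g)) \<in> I"
      by (rule sum_mem)
    also have "(\<Sum>w\<in>?S. free_scale (c w * s w) (free_scale (s w) (mon w) - ?g)) =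
        (\<Sum>w\<in>?S. free_scale (c w) (mon w)) - free_scale (\<Sum>w\<in>?S. c w * s w) ?g"
      unfolding free.scale_right_diff_distrib sum_subtractf free.scale_sum_left
      using normal_sign[OF n] by (simp add: mult.assoc)
    finally show ?thesis by (simp add: fibre)
  qed
  then have "(\<Sum>a\<in>val ` S. \<Sum>w | w \<in> S \<and> val w = a. free_scale (c w) (mon w)) \<in> I"
    by (rule sum_mem)
  then have live: "(\<Sum>w\<in>S. free_scale (c w) (mon w)) \<in> I"
    using S(1) by (simp flip: sum.image_gen)
  have "(\<Sum>w\<in>Poly_Mapping.keys f - S. free_scale (c w) (mon w)) \<in> I"
    using normal_or_mem by (intro sum_mem scale_mem) (auto simp: S_def)
  with live show "f \<in> I"
    by (subst sum_f, subst sum.subset_diff[OF S(2)]) (auto intro: add_mem)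
qed

theorem theorem7:
  shows "(Id_A :: 'k::field_char_0 free set) = T2_star_ideal hull generators"
proof (rule hull_unique[symmetric])
  show "generators \<subseteq> (Id_A :: 'k free set)" by (rule generators_subset_Id_A)
  show "T2_star_ideal (Id_A :: 'k free set)" by (rule T2_star_ideal_Id_A)
  show "Id_A \<subseteq> I" if "generators \<subseteq> I" "T2_star_ideal I" for I :: "'k free set"
    using that by (intro ideal_above_generators.Id_A_subset ideal_above_generators.intro)
qed

end
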